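(* Let $k$ be a positive integer and let $(P_{k,n})_{n\ge 0}$ be the $k$-Pell sequence. If $n\ge 2$ is an integer, then \[P_{k,n+1}=\sum_{i=0}^{\lfloor n/2\rfloor}\binom{n-i}{i}k^i 2^{n-2i}.\]
   Context: For a positive integer $k$, the $k$-Pell sequence $(P_{k,n})_{n\ge 0}$ is defined by $P_{k,0}=0$, $P_{k,1}=1$ and $P_{k,n}=2P_{k,n-1}+kP_{k,n-2}$ for $n\ge 2$. *)

theory Defs
  imports Main
begin

fun k_Pell :: "nat \<Rightarrow> nat \<Rightarrow> nat" where
  "k_Pell k 0 = 0"
| "k_Pell k (Suc 0) = 1"
| "k_Pell k (Suc (Suc n)) = 2 * k_Pell k (Suc n) + k * k_Pell k n"

end

theory Submission
  imports Defs
begin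

text \<open>Write \<open>t n i\<close> for the summand \<open>((n - i) choose i) * k ^ i * 2 ^ (n - 2 * i)\<close>. Pascal's rule
  splits \<open>t (n + 2) (i + 1)\<close> into \<open>2 * t (n + 1) (i + 1)\<close> and \<open>k * t n i\<close>. Summed over \<open>i\<close>, this is
  the recurrence of the \<open>k\<close>-Pell sequence, so the sums are the sequence, up to a shift of the index.
  The summation is carried out over the range \<open>i \<le> n\<close>: the summands beyond \<open>n div 2\<close> vanish, and
  this range grows by exactly one with each \<open>n\<close>, which avoids a distinction by the parity
  of \<open>n\<close>.\<close>

definition pell_term :: "nat \<Rightarrow> nat \<Rightarrow> nat \<Rightarrow> nat" where
  "pell_term k n i = ((n - i) choose i) * k ^ i * 2 ^ (n - 2 * i)"

lemma pell_term_eq_0: "n < 2 * i \<Longrightarrow> pell_term k n i = 0"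
  by (simp add: pell_term_def binomial_eq_0)

lemma pell_term_0: "pell_term k n 0 = 2 ^ n"
  by (simp add: pell_term_def)

lemma pell_term_Suc_Suc:
  assumes "i \<le> n"
  shows "pell_term k (Suc (Suc n)) (Suc i) = 2 * pell_term k (Suc n) (Suc i) + k * pell_term k n i"
proof -
  have pascal: "Suc (n - i) choose Suc i = ((n - i) choose i) + ((n - i) choose Suc i)"
    by simp
  \<comment> \<open>For \<open>n \<le> 2 * i\<close> the exponent on the left is truncated, but then the binomial coefficient
    vanishes.\<close>
  have shift: "2 * (((n - i) choose Suc i) * (2::nat) ^ (n - Suc (2 * i)))
      = ((n - i) choose Suc i) * 2 ^ (n - 2 * i)"
  proof (cases "2 * i < n")
    case True
    then have "n - 2 * i = Suc (n - Suc (2 * i))"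
      by simp
    then show ?thesis
      by simp
  next
    case False
    then show ?thesis
      by (simp add: binomial_eq_0)
  qed
  have "pell_term k (Suc (Suc n)) (Suc i)
      = (((n - i) choose i) + ((n - i) choose Suc i)) * k ^ Suc i * 2 ^ (n - 2 * i)"
    using assms pascal by (simp add: pell_term_def Suc_diff_le)
  also have "\<dots> = k ^ Suc i * (((n - i) choose Suc i) * 2 ^ (n - 2 * i)) + k * pell_term k n i"
    by (simp add: pell_term_def algebra_simps)
  also have "\<dots> = 2 * pell_term k (Suc n) (Suc i) + k * pell_term k n i"
    by (simp add: pell_term_def shift [symmetric])
  finally show ?thesis .
qed

lemma sum_pell_term_Suc_Suc:
  "(\<Sum>i\<le>Suc (Suc n). pell_term k (Suc (Suc n)) i)
    = 2 * (\<Sum>i\<le>Suc n. pell_term k (Suc n) i) + k * (\<Sum>i\<le>n. pell_term k n i)"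
proof -
  have "(\<Sum>i\<le>Suc (Suc n). pell_term k (Suc (Suc n)) i)
      = 2 ^ Suc (Suc n) + (\<Sum>i\<le>Suc n. pell_term k (Suc (Suc n)) (Suc i))"
    by (simp only: sum.atMost_Suc_shift pell_term_0)
  also have "(\<Sum>i\<le>Suc n. pell_term k (Suc (Suc n)) (Suc i))
      = (\<Sum>i\<le>n. pell_term k (Suc (Suc n)) (Suc i))"
    by (simp add: pell_term_eq_0)
  also have "\<dots> = (\<Sum>i\<le>n. 2 * pell_term k (Suc n) (Suc i) + k * pell_term k n i)"
    by (intro sum.cong refl pell_term_Suc_Suc) simp
  also have "\<dots> = 2 * (\<Sum>i\<le>n. pell_term k (Suc n) (Suc i)) + k * (\<Sum>i\<le>n. pell_term k n i)"
    by (simp add: sum.distrib sum_distrib_left)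
  also have "2 ^ Suc (Suc n) + \<dots>
      = 2 * (\<Sum>i\<le>Suc n. pell_term k (Suc n) i) + k * (\<Sum>i\<le>n. pell_term k n i)"
    by (simp only: sum.atMost_Suc_shift pell_term_0) simp
  finally show ?thesis .
qed

lemma k_Pell_Suc_eq_sum: "k_Pell k (Suc n) = (\<Sum>i\<le>n. pell_term k n i)"
proof (induction n rule: induct_nat_012)
  case 0
  show ?case by (simp add: pell_term_0)
next
  case 1
  show ?case by (simp add: pell_term_0 pell_term_eq_0)
next
  case (ge2 n)
  then show ?case
    by (simp only: k_Pell.simps(3) [of k "Suc n"] sum_pell_term_Suc_Suc)
qed

theorem theorem3p7:
  fixes k n :: nat
  assumes "k \<ge> 1" and "n \<ge> 2"
  shows "k_Pell k (n + 1) = (\<Sum>i=0..n div 2. ((n - i) choose i) * k ^ i * 2 ^ (n - 2 * i))"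
proof -
  have "(\<Sum>i=0..n div 2. pell_term k n i) = (\<Sum>i\<le>n. pell_term k n i)"
    by (rule sum.mono_neutral_left) (auto intro!: pell_term_eq_0)
  then show ?thesis
    by (simp add: k_Pell_Suc_eq_sum pell_term_def)
qed

end
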